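(* Let $a,b,c,d$ be real numbers with $a\ge 0$ and $b,c,d\ge 1$, and let $\alpha,\beta\ge 0$ be defined by $$\sqrt{\alpha}:=\sqrt{ab}+\sqrt{(a+1)(b-1)},\qquad \sqrt{\beta}:=\sqrt{cd}+\sqrt{(c-1)(d-1)} .$$ Then $$x_1:=(\sqrt{a+1}-\sqrt a)(\sqrt b-\sqrt{b-1})(\sqrt c-\sqrt{c-1})(\sqrt d-\sqrt{d-1})$$ and $$x_2:=-(\sqrt{a+1}+\sqrt a)(\sqrt b+\sqrt{b-1})(\sqrt c+\sqrt{c-1})(\sqrt d+\sqrt{d-1})$$ are the roots of the equation $$\frac1x-x=2\left[\sqrt{\alpha\beta}+\sqrt{(\alpha+1)(\beta-1)}\right].$$
   Context: All square roots are nonnegative real square roots. *)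

theory Defs
  imports Complex_Main
begin

end

theory Submission
  imports Defs
begin

text \<open>
  The statement is an addition theorem for hyperbolic functions. Choose \<open>A, B, C, D \<ge> 0\<close> with
  \<open>sqrt a = sinh A\<close>, \<open>sqrt b = cosh B\<close>, \<open>sqrt c = cosh C\<close>, \<open>sqrt d = cosh D\<close>. Then
  \<open>sqrt (a + 1) = cosh A\<close>, \<open>sqrt (b - 1) = sinh B\<close>, and so on, so that
  \<open>sqrt \<alpha> = sinh (A + B)\<close> and \<open>sqrt \<beta> = cosh (C + D)\<close>. The right-hand side of the equation is
  therefore \<open>2 * sinh T\<close> with \<open>T = A + B + C + D\<close>, and \<open>1 / x - x = exp T - exp (- T)\<close> has
  exactly the roots \<open>exp (- T)\<close> and \<open>- exp T\<close>. Since \<open>cosh t - sinh t = exp (- t)\<close> and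
  \<open>cosh t + sinh t = exp t\<close>, these are the two products \<open>x1\<close> and \<open>x2\<close>.

  The proof carries this out algebraically: a point \<open>(u, v)\<close> with \<open>v\<^sup>2 = u\<^sup>2 + 1\<close> plays the role
  of \<open>(sinh t, cosh t)\<close>. The lemmas \<open>sqrt_add_one_sinh_add\<close> and \<open>sqrt_diff_one_cosh_add\<close>
  supply the companion coordinate of each of the two sums \<open>A + B\<close> and \<open>C + D\<close>, and
  \<open>inverse_minus_self_roots\<close> solves the equation.
\<close>

text \<open>
  Since \<open>Y = 1 / X\<close>, the right-hand side is the value of \<open>1 / x - x\<close> at \<open>X\<close>; clearing
  denominators turns the equation into the quadratic \<open>(x - X) * (x + Y) = 0\<close>.
\<close>
lemma inverse_minus_self_roots:
  fixes X Y :: "'a :: field"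
  assumes "X * Y = 1"
  shows "{x. x \<noteq> 0 \<and> 1 / x - x = Y - X} = {X, - Y}"
proof -
  have nz: "X \<noteq> 0" "- Y \<noteq> 0"
    using assms by auto
  have "1 / x - x = Y - X \<longleftrightarrow> x = X \<or> x = - Y" if "x \<noteq> 0" for x
  proof -
    have "1 / x - x = Y - X \<longleftrightarrow> 1 - x * x = (Y - X) * x"
      using that by (simp add: field_simps)
    also have "\<dots> \<longleftrightarrow> (x - X) * (x + Y) = 0"
      using assms by (auto simp: algebra_simps)
    also have "\<dots> \<longleftrightarrow> x = X \<or> x = - Y"
      by (simp add: eq_neg_iff_add_eq_0)
    finally show ?thesis .
  qed
  then have "x \<noteq> 0 \<and> 1 / x - x = Y - X \<longleftrightarrow> x = X \<or> x = - Y" for x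
    using nz by metis
  then show ?thesis
    by (simp add: set_eq_iff)
qed

text \<open>
  With \<open>sqrt a = sinh A\<close> and \<open>sqrt b = cosh B\<close>, the hypothesis is the addition formula for
  \<open>sinh (A + B)\<close> and the conclusion the one for \<open>cosh (A + B)\<close>. The two are compatible because
  \<open>(cosh A * cosh B + sinh A * sinh B)\<^sup>2 - (sinh A * cosh B + cosh A * sinh B)\<^sup>2\<close> factors as
  \<open>((cosh A)\<^sup>2 - (sinh A)\<^sup>2) * ((cosh B)\<^sup>2 - (sinh B)\<^sup>2) = 1\<close>.
\<close>
lemma sqrt_add_one_sinh_add:
  fixes a b \<alpha> :: real
  assumes "a \<ge> 0" "b \<ge> 1" "\<alpha> \<ge> 0"
    and \<alpha>: "sqrt \<alpha> = sqrt (a * b) + sqrt ((a + 1) * (b - 1))"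
  shows "sqrt (\<alpha> + 1) = sqrt (a + 1) * sqrt b + sqrt a * sqrt (b - 1)"
proof (rule real_sqrt_unique)
  have "\<alpha> = (sqrt a * sqrt b + sqrt (a + 1) * sqrt (b - 1))\<^sup>2"
    using assms by (metis real_sqrt_mult real_sqrt_pow2)
  then show "(sqrt (a + 1) * sqrt b + sqrt a * sqrt (b - 1))\<^sup>2 = \<alpha> + 1"
    using assms by (simp add: power2_sum power_mult_distrib algebra_simps)
qed (use assms in simp)

text \<open>
  The same compatibility with \<open>sqrt c = cosh C\<close> and \<open>sqrt d = cosh D\<close>: it passes from
  \<open>cosh (C + D)\<close> to \<open>sinh (C + D)\<close>.
\<close>
lemma sqrt_diff_one_cosh_add:
  fixes c d \<beta> :: real
  assumes "c \<ge> 1" "d \<ge> 1" "\<beta> \<ge> 0"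
    and \<beta>: "sqrt \<beta> = sqrt (c * d) + sqrt ((c - 1) * (d - 1))"
  shows "sqrt (\<beta> - 1) = sqrt c * sqrt (d - 1) + sqrt (c - 1) * sqrt d"
proof (rule real_sqrt_unique)
  have "\<beta> = (sqrt c * sqrt d + sqrt (c - 1) * sqrt (d - 1))\<^sup>2"
    using assms by (metis real_sqrt_mult real_sqrt_pow2)
  then show "(sqrt c * sqrt (d - 1) + sqrt (c - 1) * sqrt d)\<^sup>2 = \<beta> - 1"
    using assms by (simp add: power2_sum power_mult_distrib algebra_simps)
qed (use assms in simp)

text \<open>This is \<open>exp (- t) * exp t = 1\<close> for \<open>sinh t = sqrt y\<close>.\<close>
lemma sqrt_add_one_conjugate:
  fixes y :: real
  assumes "y \<ge> 0"
  shows "(sqrt (y + 1) - sqrt y) * (sqrt (y + 1) + sqrt y) = 1"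
  using assms by (simp add: algebra_simps)

theorem theorem9:
  fixes a b c d \<alpha> \<beta> x1 x2 :: real
  assumes "a \<ge> 0" and "b \<ge> 1" and "c \<ge> 1" and "d \<ge> 1"
    and "\<alpha> \<ge> 0" and "\<beta> \<ge> 0"
    and "sqrt \<alpha> = sqrt (a * b) + sqrt ((a + 1) * (b - 1))"
    and "sqrt \<beta> = sqrt (c * d) + sqrt ((c - 1) * (d - 1))"
    and "x1 = (sqrt (a + 1) - sqrt a) * (sqrt b - sqrt (b - 1))
               * (sqrt c - sqrt (c - 1)) * (sqrt d - sqrt (d - 1))"
    and "x2 = - ((sqrt (a + 1) + sqrt a) * (sqrt b + sqrt (b - 1))
               * (sqrt c + sqrt (c - 1)) * (sqrt d + sqrt (d - 1)))"
  shows "{x :: real. x \<noteq> 0 \<and>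
            1 / x - x = 2 * (sqrt (\<alpha> * \<beta>) + sqrt ((\<alpha> + 1) * (\<beta> - 1)))} = {x1, x2}"
proof -
  define X where "X = (sqrt (a + 1) - sqrt a) * (sqrt b - sqrt (b - 1))
               * (sqrt c - sqrt (c - 1)) * (sqrt d - sqrt (d - 1))"
  define Y where "Y = (sqrt (a + 1) + sqrt a) * (sqrt b + sqrt (b - 1))
               * (sqrt c + sqrt (c - 1)) * (sqrt d + sqrt (d - 1))"
  have "X * Y = ((sqrt (a + 1) - sqrt a) * (sqrt (a + 1) + sqrt a))
      * ((sqrt b - sqrt (b - 1)) * (sqrt b + sqrt (b - 1)))
      * ((sqrt c - sqrt (c - 1)) * (sqrt c + sqrt (c - 1)))
      * ((sqrt d - sqrt (d - 1)) * (sqrt d + sqrt (d - 1)))"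
    unfolding X_def Y_def by (simp only: mult_ac)
  also have "\<dots> = 1"
    using sqrt_add_one_conjugate[of a] sqrt_add_one_conjugate[of "b - 1"]
      sqrt_add_one_conjugate[of "c - 1"] sqrt_add_one_conjugate[of "d - 1"] assms(1-4)
    by simp
  finally have "X * Y = 1" .

  \<comment> \<open>The addition formulas for \<open>A + B\<close>, \<open>C + D\<close> and finally \<open>(A + B) + (C + D)\<close> say that
    \<open>Y - X = exp T - exp (- T)\<close> is \<open>2 * sinh T\<close>.\<close>
  have \<alpha>: "sqrt \<alpha> = sqrt a * sqrt b + sqrt (a + 1) * sqrt (b - 1)"
    using assms(7) by (simp add: real_sqrt_mult)
  have \<beta>: "sqrt \<beta> = sqrt c * sqrt d + sqrt (c - 1) * sqrt (d - 1)"
    using assms(8) by (simp add: real_sqrt_mult)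
  have "Y - X = 2 * (sqrt \<alpha> * sqrt \<beta> + sqrt (\<alpha> + 1) * sqrt (\<beta> - 1))"
    unfolding X_def Y_def \<alpha> \<beta> sqrt_add_one_sinh_add[OF assms(1,2,5,7)]
      sqrt_diff_one_cosh_add[OF assms(3,4,6,8)]
    by (simp only: ring_distribs)
  then have "Y - X = 2 * (sqrt (\<alpha> * \<beta>) + sqrt ((\<alpha> + 1) * (\<beta> - 1)))"
    by (simp only: real_sqrt_mult)
  with inverse_minus_self_roots[OF \<open>X * Y = 1\<close>] show ?thesis
    unfolding assms(9,10) X_def[symmetric] Y_def[symmetric] by simp
qed

end
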